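(* Let $\Phi:D\rightarrow\mathbb{R}$ be a warping function with $w=(\Phi^{-1})'$ being $v$-moderate for the submultiplicative weight $v$, let $\theta\in \mathbf{L}^2_{\sqrt{v}}(\mathbb{R})$, and let $\mathbf{a}=(a_m)_{m\in\mathbb{Z}}\subset\mathbb{R}^+$. If $$\sup_{m\in\mathbb{Z}} a_m w(m)<\infty\qquad\text{and}\qquad \operatorname*{ess\,sup}_{\tau\in\mathbb{R}} \sum_{m\in\mathbb{Z}} |\theta(\tau-m)|^2<\infty,$$ then the warped filter bank $\mathcal{G}(\Phi,\theta,\mathbf{a})$ satisfies the local integrability condition (LIC). In particular, if $\mathbf{a}$ is a set of natural decimation factors for $\Phi$ (i.e. $a_m=\tilde a/w(m)$ for all $m\in\mathbb{Z}$ and some $\tilde a>0$) and $\operatorname*{ess\,sup}_{\tau\in\mathbb{R}} \sum_{m\in\mathbb{Z}} |\theta(\tau-m)|^2<\infty$, then $\mathcal{G}(\Phi,\theta,\mathbf{a})$ satisfies the LIC.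
   Context: Weights are continuous positive functions $\mathbb{R}\to\mathbb{R}^+$. A weight $v$ is submultiplicative if $v(x+y)\le v(x)v(y)$ for all $x,y\in\mathbb{R}$; a weight $w$ is $v$-moderate if $w(x+y)\le v(x)w(y)$ for all $x,y\in\mathbb{R}$. For a weight $u$, $\mathbf{L}^p_u(\mathbb{R})=\{f:\mathbb{R}\to\mathbb{C} : uf\in\mathbf{L}^p(\mathbb{R})\}$ with norm $\|uf\|_{\mathbf{L}^p}$. Warping function: for an open interval $D\subseteq\mathbb{R}$, a $\mathcal{C}^1$-diffeomorphism $\Phi:D\to\mathbb{R}$ with $\Phi'>0$ such that there is a submultiplicative weight $v$ for which $w:=(\Phi^{-1})'=1/\Phi'(\Phi^{-1}(\cdot))$ is $v$-moderate. Given $\Phi$, $w$ and $v$ always denote these weights. $\mathbf{L}^2(D)$ denotes the functions in $\mathbf{L}^2(\mathbb{R})$ vanishing almost everywhere outside $D$. The Fourier transform is $\mathcal{F}f(\xi)=\int_{\mathbb{R}} f(t)e^{-2\pi i t\xi}\,dt$, extended to $\mathbf{L}^2(\mathbb{R})$. $\mathbf{T}_xf=f(\cdot-x)$. Warped filter bank: for a warping function $\Phi$, $\theta\in\mathbf{L}^2_{\sqrt v}(\mathbb{R})$ (complex-valued) and decimation factors $\mathbf{a}=(a_m)_{m\in\mathbb{Z}}\subset\mathbb{R}^+$, $\mathcal{G}(\Phi,\theta,\mathbf{a})=(\mathbf{T}_{na_m}\mathcal{F}^{-1}(g_m))_{m,n\in\mathbb{Z}}$, where $g_m(\xi)=\sqrt{a_m}\,\theta(\Phi(\xi)-m)$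 for $\xi\in D$ and $g_m(\xi)=0$ otherwise. Local integrability condition (LIC): $\mathcal{G}(\Phi,\theta,\mathbf{a})$ satisfies the LIC if $$L(f):=\sum_{m\in\mathbb{Z}}\sum_{l\in\mathbb{Z}} a_m^{-1}\int_{\operatorname{supp}(f)} |f(\xi+la_m^{-1})g_m(\xi)|^2\,d\xi<\infty$$ for all $f\in\mathcal{D}$, where $\mathcal{D}$ is the set of all functions $f\in\mathbf{L}^\infty(D)$ with compact support contained in $D$; such $f$ are extended by zero to $\mathbb{R}$. *)

theory Defs
  imports "HOL-Analysis.Analysis" "HOL-Probability.Essential_Supremum"
begin

section \<open>Weights and weighted spaces\<close>

definition weight :: "(real \<Rightarrow> real) \<Rightarrow> bool" where
  "weight u \<longleftrightarrow> continuous_on UNIV u \<and> (\<forall>x. 0 < u x)"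

definition submultiplicative :: "(real \<Rightarrow> real) \<Rightarrow> bool" where
  "submultiplicative v \<longleftrightarrow> (\<forall>x y. v (x + y) \<le> v x * v y)"

definition moderate :: "(real \<Rightarrow> real) \<Rightarrow> (real \<Rightarrow> real) \<Rightarrow> bool" where
  "moderate v w \<longleftrightarrow> (\<forall>x y. w (x + y) \<le> v x * w y)"

text \<open>Elements of Lebesgue spaces are represented by Lebesgue measurable functions; every
  condition imposed on them below is invariant under changes on null sets.\<close>

definition L2_weighted :: "(real \<Rightarrow> real) \<Rightarrow> (real \<Rightarrow> complex) set" where
  "L2_weighted u = {f \<in> borel_measurable lebesgue.
     (\<integral>\<^sup>+x. ennreal ((norm (complex_of_real (u x) * f x))\<^sup>2) \<partial>lebesgue) < \<infinity>}"

abbreviation L2 :: "(real \<Rightarrow> complex) set" where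
  "L2 \<equiv> L2_weighted (\<lambda>_. 1)"

definition Linf_on :: "real set \<Rightarrow> (real \<Rightarrow> complex) set" where
  "Linf_on D = {f \<in> borel_measurable lebesgue.
     (\<exists>B. AE x in lebesgue. norm (f x) \<le> B) \<and> (AE x in lebesgue. x \<notin> D \<longrightarrow> f x = 0)}"

text \<open>The support of an almost-everywhere class: the complement of the largest open set on which
  it vanishes almost everywhere.\<close>

definition ess_support :: "(real \<Rightarrow> complex) \<Rightarrow> real set" where
  "ess_support f = - \<Union>{U. open U \<and> (AE x in lebesgue. x \<in> U \<longrightarrow> f x = 0)}"


section \<open>Warping functions\<close>

definition warping_weight :: "real set \<Rightarrow> (real \<Rightarrow> real) \<Rightarrow> real \<Rightarrow> real" where
  "warping_weight D \<Phi> = deriv (inv_into D \<Phi>)"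

definition C1_diffeo_onto_reals :: "real set \<Rightarrow> (real \<Rightarrow> real) \<Rightarrow> bool" where
  "C1_diffeo_onto_reals D \<Phi> \<longleftrightarrow> bij_betw \<Phi> D UNIV \<and> \<Phi> C1_differentiable_on D \<and>
     inv_into D \<Phi> C1_differentiable_on UNIV"

definition warping_function :: "real set \<Rightarrow> (real \<Rightarrow> real) \<Rightarrow> bool" where
  "warping_function D \<Phi> \<longleftrightarrow> open D \<and> is_interval D \<and> C1_diffeo_onto_reals D \<Phi> \<and>
     (\<forall>x\<in>D. 0 < deriv \<Phi> x) \<and>
     (\<exists>v. weight v \<and> submultiplicative v \<and> moderate v (warping_weight D \<Phi>))"

definition natural_decimation :: "real set \<Rightarrow> (real \<Rightarrow> real) \<Rightarrow> (int \<Rightarrow> real) \<Rightarrow> bool" where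
  "natural_decimation D \<Phi> a \<longleftrightarrow>
     (\<exists>c>0. \<forall>m. a m = c / warping_weight D \<Phi> (real_of_int m))"


section \<open>Filter banks\<close>

text \<open>The Fourier transform on $L^2$, as the $L^2$ limit of the Fourier integrals of the truncations
  to $[-R,R]$ (which lie in $L^1 \cap L^2$ and converge to the function in $L^2$).\<close>

definition L2_Fourier :: "(real \<Rightarrow> complex) \<Rightarrow> (real \<Rightarrow> complex) \<Rightarrow> bool" where
  "L2_Fourier f F \<longleftrightarrow> f \<in> L2 \<and> F \<in> L2 \<and>
     (\<lambda>R::nat. \<integral>\<^sup>+\<xi>. ennreal ((norm
        ((LINT t:{- real R..real R}|lebesgue. f t * cis (- 2 * pi * t * \<xi>)) - F \<xi>))\<^sup>2) \<partial>lebesgue)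
       \<longlonglongrightarrow> 0"

definition inverse_L2_Fourier :: "(real \<Rightarrow> complex) \<Rightarrow> real \<Rightarrow> complex" where
  "inverse_L2_Fourier g = (SOME f. L2_Fourier f g)"

definition translate :: "real \<Rightarrow> (real \<Rightarrow> complex) \<Rightarrow> real \<Rightarrow> complex" where
  "translate x f = (\<lambda>t. f (t - x))"

text \<open>The local integrability condition refers to the frequency responses \<open>g\<^sub>m\<close> and the decimation
  factors \<open>a\<^sub>m\<close>, so a filter bank is given by this data; the functions it consists of are
  \<open>filter_bank_atom G m n\<close>.\<close>

record filter_bank =
  response :: "int \<Rightarrow> real \<Rightarrow> complex"
  decimation :: "int \<Rightarrow> real"

definition filter_bank_atom :: "filter_bank \<Rightarrow> int \<Rightarrow> int \<Rightarrow> real \<Rightarrow> complex" where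
  "filter_bank_atom G m n =
     translate (real_of_int n * decimation G m) (inverse_L2_Fourier (response G m))"

definition warped_filter_bank ::
    "real set \<Rightarrow> (real \<Rightarrow> real) \<Rightarrow> (real \<Rightarrow> complex) \<Rightarrow> (int \<Rightarrow> real) \<Rightarrow> filter_bank" where
  "warped_filter_bank D \<Phi> \<theta> a =
     \<lparr> response = (\<lambda>m \<xi>. if \<xi> \<in> D
         then complex_of_real (sqrt (a m)) * \<theta> (\<Phi> \<xi> - real_of_int m) else 0),
       decimation = a \<rparr>"

definition LIC_test_functions :: "real set \<Rightarrow> (real \<Rightarrow> complex) set" where
  "LIC_test_functions D = {f \<in> Linf_on D. compact (ess_support f) \<and> ess_support f \<subseteq> D}"

definition LIC_sum :: "filter_bank \<Rightarrow> (real \<Rightarrow> complex) \<Rightarrow> ennreal" where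
  "LIC_sum G f = (\<Sum>\<^sub>\<infinity>m::int. \<Sum>\<^sub>\<infinity>l::int. ennreal (inverse (decimation G m)) *
     (\<integral>\<^sup>+\<xi>\<in>ess_support f. ennreal ((norm
        (f (\<xi> + real_of_int l * inverse (decimation G m)) * response G m \<xi>))\<^sup>2) \<partial>lebesgue))"

definition satisfies_LIC :: "real set \<Rightarrow> filter_bank \<Rightarrow> bool" where
  "satisfies_LIC D G \<longleftrightarrow> (\<forall>f\<in>LIC_test_functions D. LIC_sum G f < \<infinity>)"

end

theory Submission
  imports Defs
begin

text \<open>A test function \<open>f\<close> is bounded and supported in a compact \<open>K \<subseteq> D\<close>, so at each point at most
  \<open>1 + a\<^sub>m diam K\<close> of its translates by multiples of \<open>1/a\<^sub>m\<close> contribute, and the inner sum of the LIC is at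
  most a constant times \<open>(1 + a\<^sub>m diam K) \<integral>\<^sub>K |\<theta>(\<Phi>(\<xi>) - m)|\<^sup>2 d\<xi>\<close>. Substituting \<open>\<tau> = \<Phi>(\<xi>)\<close> turns the integral
  into one of \<open>w(\<tau>) |\<theta>(\<tau> - m)|\<^sup>2\<close> over the compact set \<open>\<Phi>(K)\<close>. The terms without the factor \<open>a\<^sub>m\<close> sum up
  by the bound on the periodization of \<open>|\<theta>|\<^sup>2\<close>. For the terms with it, moderateness gives
  \<open>a\<^sub>m w(\<tau>) \<le> a\<^sub>m w(m) v(\<tau> - m)\<close>, and the integer translates of \<open>\<Phi>(K)\<close> overlap boundedly often, so
  their sum is controlled by \<open>\<integral> v |\<theta>|\<^sup>2\<close>.\<close>

section \<open>Sums over the integers and null sets\<close>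

text \<open>Every family in \<open>ennreal\<close> is summable, its sum being the supremum of the
  finite partial sums. Both sums of the LIC are thereby reduced to finite ones, and sums and
  integrals are interchanged only over finite index sets.\<close>

lemma infsum_ennreal_leI:
  fixes f :: "'a \<Rightarrow> ennreal"
  assumes "\<And>F. finite F \<Longrightarrow> sum f F \<le> C"
  shows "infsum f A \<le> C"
  by (intro infsum_le_finite_sums nonneg_summable_on_complete) (auto simp: assms)

lemma sum_le_infsum_ennreal:
  fixes f :: "'a \<Rightarrow> ennreal"
  assumes "finite F" "F \<subseteq> A"
  shows "sum f F \<le> infsum f A"
proof -
  have "infsum f F \<le> infsum f A"
    using assms by (intro infsum_mono_neutral nonneg_summable_on_complete) auto
  then show ?thesis
    using assms by simp
qed

section \<open>Counting integer translates that hit an interval\<close>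

lemma card_ints_between:
  fixes x y :: real
  assumes "finite F" "x \<le> y" "\<And>l::int. l \<in> F \<Longrightarrow> x \<le> l \<and> l \<le> y"
  shows "card F \<le> 1 + (y - x)"
proof -
  have "F \<subseteq> {\<lceil>x\<rceil>..\<lfloor>y\<rfloor>}"
    using assms(3) by (auto simp: ceiling_le_iff le_floor_iff)
  then have "card F \<le> nat (\<lfloor>y\<rfloor> - \<lceil>x\<rceil> + 1)"
    using card_mono[of "{\<lceil>x\<rceil>..\<lfloor>y\<rfloor>}" F] by simp
  \<comment> \<open>When \<open>nat\<close> truncates, the claim becomes
    \<open>0 \<le> 1 + (y - x)\<close>, which follows from \<open>x \<le> y\<close>.\<close>
  moreover have "real (nat (\<lfloor>y\<rfloor> - \<lceil>x\<rceil> + 1)) \<le> 1 + (y - x)"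
    using assms(2) by linarith
  ultimately show ?thesis
    by linarith
qed

text \<open>The admissible \<open>l\<close> lie between \<open>(x - t) / s\<close> and
  \<open>(y - t) / s\<close>, and these bounds are \<open>(y - x) / s\<close> apart. The spacing is
  \<open>1 / a m\<close> for the translates of a test function and 1 for the integer translates in
  the sum over \<open>m\<close>.\<close>

lemma sum_indicator_translates_le:
  fixes s t x y :: real
  assumes "finite F" "0 < s" "x \<le> y"
  shows "(\<Sum>l\<in>F. indicator {x..y} (t + real_of_int l * s)) \<le> ennreal (1 + (y - x) / s)"
proof -
  define F' where "F' = {l\<in>F. t + real_of_int l * s \<in> {x..y}}"
  have "(\<Sum>l\<in>F. indicator {x..y} (t + real_of_int l * s)) = (\<Sum>l\<in>F'. 1::ennreal)"
    unfolding F'_def using assms(1) by (intro sum.mono_neutral_cong_right) (auto simp: indicator_def)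
  also have "\<dots> = ennreal (card F')"
    by (simp add: ennreal_of_nat_eq_real_of_nat)
  also have "\<dots> \<le> ennreal (1 + ((y - t) / s - (x - t) / s))"
    using assms by (intro ennreal_leI card_ints_between) (auto simp: F'_def divide_simps)
  also have "(y - t) / s - (x - t) / s = (y - x) / s"
    by (simp flip: diff_divide_distrib)
  finally show ?thesis .
qed

lemma AE_lborel_shift:
  fixes c :: real
  assumes "AE x in lborel. P x"
  shows "AE x in lborel. P (c + x)"
proof -
  have "AE x in distr lborel borel ((+) c). P x"
    using assms unfolding lborel_distr_plus .
  then show ?thesis
    by (rule AE_distrD[rotated]) simp
qed

text \<open>Substituting \<open>t = \<tau> - m\<close> moves the translation from \<open>h\<close>
  to the interval, whose integer translates cover each point at most
  \<open>1 + (\<beta> - \<alpha>)\<close> times.\<close>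

lemma sum_nn_integral_int_translates_le:
  fixes h :: "real \<Rightarrow> ennreal"
  assumes [measurable]: "h \<in> borel_measurable borel" and "finite F" "\<alpha> \<le> \<beta>"
  shows "(\<Sum>m\<in>F. \<integral>\<^sup>+\<tau>. h (\<tau> - real_of_int m) * indicator {\<alpha>..\<beta>} \<tau> \<partial>lborel)
    \<le> ennreal (1 + (\<beta> - \<alpha>)) * (\<integral>\<^sup>+t. h t \<partial>lborel)"
proof -
  \<comment> \<open>The factor \<open>* 1\<close> displays the spacing \<open>s = 1\<close> of
    \<open>sum_indicator_translates_le\<close>.\<close>
  have "(\<Sum>m\<in>F. \<integral>\<^sup>+\<tau>. h (\<tau> - real_of_int m) * indicator {\<alpha>..\<beta>} \<tau> \<partial>lborel)
      = (\<Sum>m\<in>F. \<integral>\<^sup>+t. h t * indicator {\<alpha>..\<beta>} (t + real_of_int m * 1) \<partial>lborel)"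
  proof (intro sum.cong refl)
    fix m :: int
    show "(\<integral>\<^sup>+\<tau>. h (\<tau> - real_of_int m) * indicator {\<alpha>..\<beta>} \<tau> \<partial>lborel)
        = (\<integral>\<^sup>+t. h t * indicator {\<alpha>..\<beta>} (t + real_of_int m * 1) \<partial>lborel)"
      by (subst nn_integral_real_affine[of _ 1 "real_of_int m"]) (auto simp: add.commute)
  qed
  also have "\<dots> = (\<integral>\<^sup>+t. h t * (\<Sum>m\<in>F. indicator {\<alpha>..\<beta>} (t + real_of_int m * 1)) \<partial>lborel)"
    by (subst nn_integral_sum[symmetric]) (simp_all add: sum_distrib_left)
  also have "\<dots> \<le> (\<integral>\<^sup>+t. h t * ennreal (1 + (\<beta> - \<alpha>) / 1) \<partial>lborel)"
    using assms by (intro nn_integral_mono mult_left_mono sum_indicator_translates_le) auto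
  also have "\<dots> = ennreal (1 + (\<beta> - \<alpha>)) * (\<integral>\<^sup>+t. h t \<partial>lborel)"
    by (simp add: nn_integral_multc mult.commute)
  finally show ?thesis .
qed

text \<open>The union defining the complement of the support may be uncountable. By Lindelof a
  countable subfamily has the same union, and countably many exceptional null sets still form a null
  set.\<close>

lemma AE_zero_off_ess_support: "AE x in lebesgue. x \<notin> ess_support f \<longrightarrow> f x = 0"
proof -
  let ?\<U> = "{U. open U \<and> (AE x in lebesgue. x \<in> U \<longrightarrow> f x = 0)}"
  obtain \<V> where \<V>: "\<V> \<subseteq> ?\<U>" "countable \<V>" "\<Union>\<V> = \<Union>?\<U>"
    using Lindelof[of ?\<U>] by (metis (mono_tags, lifting) mem_Collect_eq)
  have "AE x in lebesgue. \<forall>U\<in>\<V>. x \<in> U \<longrightarrow> f x = 0"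
    using \<V> by (intro AE_ball_countable') auto
  then show ?thesis
  proof eventually_elim
    case (elim x)
    then show ?case
      unfolding ess_support_def \<V>(3)[symmetric] by blast
  qed
qed

section \<open>Change of variables by a warping function\<close>

lemma warping_function_inverse:
  assumes "warping_function D \<Phi>"
  shows "inv_into D \<Phi> y \<in> D" "\<Phi> (inv_into D \<Phi> y) = y"
    and "\<xi> \<in> D \<Longrightarrow> inv_into D \<Phi> (\<Phi> \<xi>) = \<xi>"
  using assms unfolding warping_function_def C1_diffeo_onto_reals_def bij_betw_def
  by (auto intro: inv_into_into f_inv_into_f)

lemma warping_function_continuous_on:
  assumes "warping_function D \<Phi>"
  shows "continuous_on D \<Phi>"
  using assms C1_differentiable_imp_continuous_on
  unfolding warping_function_def C1_diffeo_onto_reals_def by blast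

lemma warping_function_inverse_deriv:
  assumes "warping_function D \<Phi>"
  shows "(inv_into D \<Phi> has_real_derivative warping_weight D \<Phi> y) (at y)"
    and "0 < warping_weight D \<Phi> y"
    and "continuous_on S (warping_weight D \<Phi>)"
proof -
  let ?g = "inv_into D \<Phi>" and ?w = "warping_weight D \<Phi>"
  note inv = warping_function_inverse[OF assms]
  from assms have "\<Phi> C1_differentiable_on D" and g_C1: "?g C1_differentiable_on UNIV"
    and pos: "\<forall>x\<in>D. 0 < deriv \<Phi> x"
    unfolding warping_function_def C1_diffeo_onto_reals_def by auto
  then have dPhi: "(\<Phi> has_real_derivative deriv \<Phi> x) (at x)" if "x \<in> D" for x
    using that unfolding C1_differentiable_on_def has_real_derivative_iff_has_vector_derivative[symmetric]
    by (metis DERIV_imp_deriv)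
  obtain w' where w': "\<And>y. (?g has_real_derivative w' y) (at y)" "continuous_on UNIV w'"
    using g_C1 unfolding C1_differentiable_on_def has_real_derivative_iff_has_vector_derivative[symmetric]
    by auto
  have eq: "?w = w'"
    using w'(1) unfolding warping_weight_def by (auto intro: DERIV_imp_deriv)
  show dg: "(?g has_real_derivative ?w y) (at y)" for y
    using w'(1) eq by simp
  show "continuous_on S ?w"
    using w'(2) eq continuous_on_subset by blast
  \<comment> \<open>Differentiating \<open>\<Phi> (?g y) = y\<close> shows that \<open>?w y\<close>
    is the reciprocal of \<open>deriv \<Phi> (?g y)\<close>, hence positive.\<close>
  have "((\<lambda>y. \<Phi> (?g y)) has_real_derivative deriv \<Phi> (?g y) * ?w y) (at y)"
    by (rule DERIV_chain2[OF dPhi dg]) (rule inv)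
  then have "((\<lambda>y. y) has_real_derivative deriv \<Phi> (?g y) * ?w y) (at y)"
    by (simp add: inv)
  then have "deriv \<Phi> (?g y) * ?w y = 1"
    using DERIV_ident DERIV_unique by blast
  moreover have "0 < deriv \<Phi> (?g y)"
    using pos inv by blast
  ultimately show "0 < ?w y"
    by (metis zero_less_mult_pos zero_less_one)
qed

lemma warping_function_inverse_less:
  assumes "warping_function D \<Phi>" "x < y"
  shows "inv_into D \<Phi> x < inv_into D \<Phi> y"
  using warping_function_inverse_deriv[OF assms(1)] by (intro DERIV_pos_imp_increasing[OF assms(2)]) blast

lemma warping_function_interval_subset:
  assumes "warping_function D \<Phi>"
  shows "{inv_into D \<Phi> \<alpha>..inv_into D \<Phi> \<beta>} \<subseteq> D"
proof -
  have "is_interval D"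
    using assms unfolding warping_function_def by blast
  then show ?thesis
    using warping_function_inverse(1)[OF assms] unfolding is_interval_1 by (meson atLeastAtMost_iff subsetI)
qed

lemma compact_in_warped_interval:
  assumes "warping_function D \<Phi>" "compact K" "K \<subseteq> D"
  obtains \<alpha> \<beta> where "\<alpha> < \<beta>" "K \<subseteq> {inv_into D \<Phi> \<alpha>..inv_into D \<Phi> \<beta>}"
proof -
  have "compact (\<Phi> ` K)"
    using assms compact_continuous_image continuous_on_subset warping_function_continuous_on by metis
  from compact_imp_bounded[OF this]
  obtain B where "\<forall>y\<in>\<Phi> ` K. norm y \<le> B"
    unfolding bounded_iff by blast
  then have B: "\<And>x. x \<in> K \<Longrightarrow> \<bar>\<Phi> x\<bar> \<le> B"
    by simp
  \<comment> \<open>The absolute value covers a negative \<open>B\<close>, possible for empty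
    \<open>K\<close>. The extra 1 gives \<open>\<alpha> < \<beta>\<close> and strict inequalities
    for the strictly increasing inverse.\<close>
  have "K \<subseteq> {inv_into D \<Phi> (- \<bar>B\<bar> - 1)..inv_into D \<Phi> (\<bar>B\<bar> + 1)}"
  proof
    fix x assume x: "x \<in> K"
    then have "- \<bar>B\<bar> - 1 < \<Phi> x" "\<Phi> x < \<bar>B\<bar> + 1"
      using B[OF x] by auto
    then show "x \<in> {inv_into D \<Phi> (- \<bar>B\<bar> - 1)..inv_into D \<Phi> (\<bar>B\<bar> + 1)}"
      using warping_function_inverse_less[OF assms(1)] warping_function_inverse(3)[OF assms(1)] x assms(3)
      by (metis atLeastAtMost_iff less_imp_le subsetD)
  qed
  then show ?thesis
    by (intro that[of "- \<bar>B\<bar> - 1" "\<bar>B\<bar> + 1"]) auto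
qed

section \<open>Measurability, substitution and null sets under the warping\<close>

text \<open>Nothing is known about \<open>\<Phi>\<close> off \<open>D\<close>, so it is cut off to a
  compact interval inside \<open>D\<close>, where it is continuous. The indicator factor hides the
  change.\<close>

lemma borel_measurable_warped:
  fixes H :: "real \<Rightarrow> ennreal"
  assumes "warping_function D \<Phi>" and [measurable]: "H \<in> borel_measurable borel"
  shows "(\<lambda>\<xi>. H (\<Phi> \<xi>) * indicator {inv_into D \<Phi> \<alpha>..inv_into D \<Phi> \<beta>} \<xi>) \<in> borel_measurable borel"
proof -
  let ?J = "{inv_into D \<Phi> \<alpha>..inv_into D \<Phi> \<beta>}"
  have "continuous_on ?J \<Phi>"
    by (rule continuous_on_subset[OF warping_function_continuous_on warping_function_interval_subset]) (rule assms)+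
  then have [measurable]: "(\<lambda>\<xi>. indicator ?J \<xi> *\<^sub>R \<Phi> \<xi>) \<in> borel_measurable borel"
    by (intro borel_measurable_continuous_on_indicator) auto
  have "H (\<Phi> \<xi>) * indicator ?J \<xi> = H (indicator ?J \<xi> *\<^sub>R \<Phi> \<xi>) * indicator ?J \<xi>" for \<xi>
    by (cases "\<xi> \<in> ?J") simp_all
  moreover have "(\<lambda>\<xi>. H (indicator ?J \<xi> *\<^sub>R \<Phi> \<xi>) * indicator ?J \<xi>) \<in> borel_measurable borel"
    by measurable
  ultimately show ?thesis
    by presburger
qed

text \<open>This is the substitution \<open>\<xi> = inv_into D \<Phi> \<tau>\<close>; the weight is
  its Jacobian.\<close>

lemma nn_integral_warped:
  fixes H :: "real \<Rightarrow> ennreal"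
  assumes "warping_function D \<Phi>" and H: "H \<in> borel_measurable borel" and "\<alpha> < \<beta>"
  shows "(\<integral>\<^sup>+\<xi>. H (\<Phi> \<xi>) * indicator {inv_into D \<Phi> \<alpha>..inv_into D \<Phi> \<beta>} \<xi> \<partial>lborel)
    = (\<integral>\<^sup>+\<tau>. H \<tau> * ennreal (warping_weight D \<Phi> \<tau>) * indicator {\<alpha>..\<beta>} \<tau> \<partial>lborel)"
proof -
  let ?g = "inv_into D \<Phi>"
  let ?J = "{?g \<alpha>..?g \<beta>}"
  have mono: "?g x \<le> ?g y" if "x \<le> y" for x y
    using warping_function_inverse_less[OF assms(1), of x y] that by (cases "x = y") auto
  \<comment> \<open>The indicator is doubled: one copy keeps the integrand Borel on the whole line,
    the other is the domain of integration in the substitution rule.\<close>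
  have "(\<integral>\<^sup>+\<xi>. H (\<Phi> \<xi>) * indicator ?J \<xi> \<partial>lborel)
      = (\<integral>\<^sup>+\<xi>. (H (\<Phi> \<xi>) * indicator ?J \<xi>) * indicator ?J \<xi> \<partial>lborel)"
    by (intro nn_integral_cong) (auto simp: indicator_def)
  also have "\<dots> = (\<integral>\<^sup>+\<tau>. (H (\<Phi> (?g \<tau>)) * indicator ?J (?g \<tau>)) * ennreal (warping_weight D \<Phi> \<tau>)
      * indicator {\<alpha>..\<beta>} \<tau> \<partial>lborel)"
    by (rule nn_integral_substitution_aux[OF borel_measurable_warped[OF assms(1) H]])
      (simp_all only: warping_function_inverse_deriv[OF assms(1)] less_imp_le \<open>\<alpha> < \<beta>\<close> zero_le)
  also have "\<dots> = (\<integral>\<^sup>+\<tau>. H \<tau> * ennreal (warping_weight D \<Phi> \<tau>) * indicator {\<alpha>..\<beta>} \<tau> \<partial>lborel)"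
    by (intro nn_integral_cong) (simp add: indicator_def warping_function_inverse(2)[OF assms(1)] mono)
  finally show ?thesis .
qed

text \<open>Facts about \<open>\<theta>\<close> hold only almost everywhere but are needed at
  \<open>\<Phi> \<xi>\<close>. Substitution with the indicator of a Borel null set containing the
  exceptional points shows that their preimage in the interval is null.\<close>

lemma AE_warped:
  assumes "warping_function D \<Phi>" "\<alpha> < \<beta>" "AE t in lborel. P t"
  shows "AE \<xi> in lborel. \<xi> \<in> {inv_into D \<Phi> \<alpha>..inv_into D \<Phi> \<beta>} \<longrightarrow> P (\<Phi> \<xi>)"
proof -
  let ?J = "{inv_into D \<Phi> \<alpha>..inv_into D \<Phi> \<beta>}"
  obtain N where N: "N \<in> null_sets lborel" "{t. \<not> P t} \<subseteq> N"
    using assms(3) unfolding eventually_ae_filter by auto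
  have [measurable]: "N \<in> sets borel"
    using N by (auto simp: null_sets_def)
  have "(\<integral>\<^sup>+\<xi>. indicator N (\<Phi> \<xi>) * indicator ?J \<xi> \<partial>lborel)
      = (\<integral>\<^sup>+\<tau>. indicator N \<tau> * ennreal (warping_weight D \<Phi> \<tau>) * indicator {\<alpha>..\<beta>} \<tau> \<partial>lborel)"
    by (intro nn_integral_warped assms) simp
  also have "\<dots> = (\<integral>\<^sup>+\<tau>. 0 \<partial>(lborel :: real measure))"
    using AE_not_in[OF N(1)] by (intro nn_integral_cong_AE) (elim eventually_mono, simp)
  finally have "(\<integral>\<^sup>+\<xi>. indicator N (\<Phi> \<xi>) * indicator ?J \<xi> \<partial>lborel) = 0"
    by simp
  then have "AE \<xi> in lborel. (indicator N (\<Phi> \<xi>) * indicator ?J \<xi> :: ennreal) = 0"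
    by (intro nn_integral_0_iff_AE[THEN iffD1]) (auto intro!: borel_measurable_warped assms)
  then show ?thesis
  proof eventually_elim
    case (elim \<xi>)
    then show ?case
      using N(2) by (auto simp: indicator_def split: if_splits)
  qed
qed

section \<open>The local integrability condition\<close>

text \<open>After exchanging sum and integral, the periodization bound \<open>M\<close> holds at
  \<open>\<Phi> \<xi>\<close> for almost every \<open>\<xi>\<close> in the interval, whose length is
  the remaining factor.\<close>

lemma sum_warped_translates_le:
  fixes H :: "real \<Rightarrow> ennreal"
  assumes "warping_function D \<Phi>" and [measurable]: "H \<in> borel_measurable borel"
    and "\<alpha> < \<beta>" "finite F"
    and M: "AE \<tau> in lborel. (\<Sum>m\<in>F. H (\<tau> - real_of_int m)) \<le> M"
  shows "(\<Sum>m\<in>F. \<integral>\<^sup>+\<xi>. H (\<Phi> \<xi> - real_of_int m)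
        * indicator {inv_into D \<Phi> \<alpha>..inv_into D \<Phi> \<beta>} \<xi> \<partial>lborel)
    \<le> M * ennreal (inv_into D \<Phi> \<beta> - inv_into D \<Phi> \<alpha>)"
proof -
  let ?J = "{inv_into D \<Phi> \<alpha>..inv_into D \<Phi> \<beta>}"
  have meas: "(\<lambda>\<xi>. H (\<Phi> \<xi> - real_of_int m) * indicator ?J \<xi>) \<in> borel_measurable borel" for m
    by (rule borel_measurable_warped[OF assms(1), of "\<lambda>t. H (t - real_of_int m)"]) simp
  have "(\<Sum>m\<in>F. \<integral>\<^sup>+\<xi>. H (\<Phi> \<xi> - real_of_int m) * indicator ?J \<xi> \<partial>lborel)
      = (\<integral>\<^sup>+\<xi>. (\<Sum>m\<in>F. H (\<Phi> \<xi> - real_of_int m)) * indicator ?J \<xi> \<partial>lborel)"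
    using meas by (subst nn_integral_sum[symmetric]) (simp_all add: sum_distrib_right)
  also have "\<dots> \<le> (\<integral>\<^sup>+\<xi>. M * indicator ?J \<xi> \<partial>lborel)"
    using AE_warped[OF assms(1,3) M]
    by (intro nn_integral_mono_AE) (elim eventually_mono, simp add: indicator_def)
  also have "\<dots> = M * ennreal (inv_into D \<Phi> \<beta> - inv_into D \<Phi> \<alpha>)"
    using warping_function_inverse_less[OF assms(1,3)] by (simp add: nn_integral_cmult_indicator)
  finally show ?thesis .
qed

lemma sum_weighted_warped_translates_le:
  fixes H :: "real \<Rightarrow> ennreal" and a :: "int \<Rightarrow> real"
  assumes "warping_function D \<Phi>" and [measurable]: "H \<in> borel_measurable borel"
    and "\<alpha> < \<beta>" "finite F"
    and v: "weight v" "moderate v (warping_weight D \<Phi>)"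
    and a: "\<And>m. 0 < a m" "\<And>m. a m * warping_weight D \<Phi> (real_of_int m) \<le> C"
  shows "(\<Sum>m\<in>F. ennreal (a m) * (\<integral>\<^sup>+\<xi>. H (\<Phi> \<xi> - real_of_int m)
        * indicator {inv_into D \<Phi> \<alpha>..inv_into D \<Phi> \<beta>} \<xi> \<partial>lborel))
    \<le> ennreal C * (ennreal (1 + (\<beta> - \<alpha>)) * (\<integral>\<^sup>+t. ennreal (v t) * H t \<partial>lborel))"
proof -
  let ?J = "{inv_into D \<Phi> \<alpha>..inv_into D \<Phi> \<beta>}" and ?w = "warping_weight D \<Phi>"
  note w = warping_function_inverse_deriv(2,3)[OF assms(1)]
  have [measurable]: "?w \<in> borel_measurable borel" "v \<in> borel_measurable borel"
    using w v(1) unfolding weight_def by (auto intro: borel_measurable_continuous_onI)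
  have v_pos: "0 < v x" for x
    using v(1) unfolding weight_def by blast
  \<comment> \<open>Moderateness for \<open>\<tau> = (\<tau> - m) + m\<close> trades the weight at
    \<open>\<tau>\<close> for the weight at \<open>m\<close>, which together with \<open>a m\<close>
    is at most \<open>C\<close>. The price \<open>v (\<tau> - m)\<close> is translated along with
    \<open>H\<close>.\<close>
  have aw: "a m * ?w \<tau> \<le> C * v (\<tau> - real_of_int m)" for m \<tau>
  proof -
    have "?w \<tau> \<le> v (\<tau> - real_of_int m) * ?w (real_of_int m)"
      using v(2) unfolding moderate_def by (metis diff_add_cancel)
    then have "a m * ?w \<tau> \<le> (a m * ?w (real_of_int m)) * v (\<tau> - real_of_int m)"
      using a(1)[of m] by (simp add: mult_ac)
    also have "\<dots> \<le> C * v (\<tau> - real_of_int m)"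
      using a(2) v_pos by (intro mult_right_mono) (auto intro: less_imp_le)
    finally show ?thesis .
  qed
  have "ennreal (a m) * (\<integral>\<^sup>+\<xi>. H (\<Phi> \<xi> - real_of_int m) * indicator ?J \<xi> \<partial>lborel)
      \<le> ennreal C * (\<integral>\<^sup>+\<tau>. ennreal (v (\<tau> - real_of_int m)) * H (\<tau> - real_of_int m)
        * indicator {\<alpha>..\<beta>} \<tau> \<partial>lborel)" for m
  proof -
    have "(\<integral>\<^sup>+\<xi>. H (\<Phi> \<xi> - real_of_int m) * indicator ?J \<xi> \<partial>lborel)
        = (\<integral>\<^sup>+\<tau>. H (\<tau> - real_of_int m) * ennreal (?w \<tau>) * indicator {\<alpha>..\<beta>} \<tau> \<partial>lborel)"
      by (rule nn_integral_warped[OF assms(1), of "\<lambda>t. H (t - real_of_int m)"]) (simp_all add: assms)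
    then have "ennreal (a m) * (\<integral>\<^sup>+\<xi>. H (\<Phi> \<xi> - real_of_int m) * indicator ?J \<xi> \<partial>lborel)
        = ennreal (a m) * (\<integral>\<^sup>+\<tau>. H (\<tau> - real_of_int m) * ennreal (?w \<tau>) * indicator {\<alpha>..\<beta>} \<tau> \<partial>lborel)"
      by simp
    also have "\<dots> = (\<integral>\<^sup>+\<tau>. ennreal (a m * ?w \<tau>) * (H (\<tau> - real_of_int m) * indicator {\<alpha>..\<beta>} \<tau>) \<partial>lborel)"
      using a(1)[of m] w(1)
      by (subst nn_integral_cmult[symmetric])
        (auto simp: ennreal_mult less_imp_le mult_ac intro!: nn_integral_cong)
    also have "\<dots> \<le> (\<integral>\<^sup>+\<tau>. ennreal (C * v (\<tau> - real_of_int m))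
        * (H (\<tau> - real_of_int m) * indicator {\<alpha>..\<beta>} \<tau>) \<partial>lborel)"
      using aw by (intro nn_integral_mono mult_right_mono ennreal_leI) auto
    also have "\<dots> = ennreal C * (\<integral>\<^sup>+\<tau>. ennreal (v (\<tau> - real_of_int m)) * H (\<tau> - real_of_int m)
        * indicator {\<alpha>..\<beta>} \<tau> \<partial>lborel)"
      using v_pos
      by (subst nn_integral_cmult[symmetric])
        (auto simp: ennreal_mult'' less_imp_le mult_ac intro!: nn_integral_cong)
    finally show ?thesis .
  qed
  then have "(\<Sum>m\<in>F. ennreal (a m) * (\<integral>\<^sup>+\<xi>. H (\<Phi> \<xi> - real_of_int m) * indicator ?J \<xi> \<partial>lborel))
      \<le> ennreal C * (\<Sum>m\<in>F. \<integral>\<^sup>+\<tau>. ennreal (v (\<tau> - real_of_int m)) * H (\<tau> - real_of_int m)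
        * indicator {\<alpha>..\<beta>} \<tau> \<partial>lborel)"
    unfolding sum_distrib_left by (intro sum_mono)
  also have "\<dots> \<le> ennreal C * (ennreal (1 + (\<beta> - \<alpha>)) * (\<integral>\<^sup>+t. ennreal (v t) * H t \<partial>lborel))"
    using assms(3,4)
    by (intro mult_left_mono sum_nn_integral_int_translates_le[of "\<lambda>t. ennreal (v t) * H t"]) auto
  finally show ?thesis .
qed

section \<open>The inner sum over the translates of a test function\<close>

text \<open>\<open>H\<close> stands for a Borel version of the squared modulus of
  \<open>\<theta>\<close>. The bound keeps \<open>1 + L * a m\<close>, with \<open>L\<close> the
  length of the interval, because its two terms are summed over \<open>m\<close> by different
  arguments.\<close>

lemma LIC_inner_sum_le:
  fixes f :: "real \<Rightarrow> complex" and a :: "int \<Rightarrow> real"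
  assumes "warping_function D \<Phi>" "\<alpha> < \<beta>" and a: "0 < a m"
    and f: "AE x in lebesgue. norm (f x) \<le> B"
    and supp: "ess_support f \<subseteq> {inv_into D \<Phi> \<alpha>..inv_into D \<Phi> \<beta>}"
    and H[measurable]: "H \<in> borel_measurable borel"
    and \<theta>: "AE t in lborel. ennreal ((norm (\<theta> t))\<^sup>2) = H t"
  shows "(\<Sum>\<^sub>\<infinity>l::int. ennreal (inverse (a m)) * (\<integral>\<^sup>+\<xi>\<in>ess_support f. ennreal ((norm
        (f (\<xi> + real_of_int l * inverse (a m)) * response (warped_filter_bank D \<Phi> \<theta> a) m \<xi>))\<^sup>2) \<partial>lebesgue))
    \<le> ennreal (B\<^sup>2) * (ennreal (1 + (inv_into D \<Phi> \<beta> - inv_into D \<Phi> \<alpha>) * a m)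
        * (\<integral>\<^sup>+\<xi>. H (\<Phi> \<xi> - real_of_int m) * indicator {inv_into D \<Phi> \<alpha>..inv_into D \<Phi> \<beta>} \<xi> \<partial>lborel))"
proof (rule infsum_ennreal_leI)
  fix F :: "int set"
  assume "finite F"
  let ?J = "{inv_into D \<Phi> \<alpha>..inv_into D \<Phi> \<beta>}" and ?s = "inverse (a m)"
  let ?g = "response (warped_filter_bank D \<Phi> \<theta> a) m"
  define h where "h = (\<lambda>\<xi>. H (\<Phi> \<xi> - real_of_int m) * indicator ?J \<xi>)"
  have [measurable]: "h \<in> borel_measurable borel"
    unfolding h_def by (rule borel_measurable_warped[OF assms(1), of "\<lambda>t. H (t - real_of_int m)"]) simp
  have s: "0 < ?s"
    using a by simp
  have f_bound: "AE x in lborel. (norm (f x))\<^sup>2 \<le> B\<^sup>2 * indicator ?J x"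
  proof -
    have "AE x in lebesgue. (norm (f x))\<^sup>2 \<le> B\<^sup>2 * indicator ?J x"
      using f AE_zero_off_ess_support[of f]
    proof eventually_elim
      case (elim x)
      then show ?case
        using supp by (cases "x \<in> ess_support f") (auto simp: subset_iff power_mono)
    qed
    then show ?thesis
      by (simp add: AE_completion_iff)
  qed
  \<comment> \<open>The interval lies in \<open>D\<close>, so the response is given there by its
    nonzero branch, and squaring \<open>sqrt (a m)\<close> produces the factor
    \<open>a m\<close>.\<close>
  have g: "AE \<xi> in lborel. \<xi> \<in> ?J \<longrightarrow> ennreal ((norm (?g \<xi>))\<^sup>2) = ennreal (a m) * h \<xi>"
  proof -
    have "AE t in lborel. ennreal ((norm (\<theta> (- real_of_int m + t)))\<^sup>2) = H (- real_of_int m + t)"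
      by (rule AE_lborel_shift[OF \<theta>])
    from AE_warped[OF assms(1,2) this] show ?thesis
    proof eventually_elim
      case (elim \<xi>)
      then show ?case
        using warping_function_interval_subset[OF assms(1), of \<alpha> \<beta>] a
        by (auto simp: warped_filter_bank_def h_def norm_mult power_mult_distrib ennreal_mult' subset_iff)
    qed
  qed
  have "ennreal ?s * (\<integral>\<^sup>+\<xi>\<in>ess_support f. ennreal ((norm (f (\<xi> + real_of_int l * ?s) * ?g \<xi>))\<^sup>2) \<partial>lebesgue)
      \<le> ennreal (B\<^sup>2) * (\<integral>\<^sup>+\<xi>. indicator ?J (\<xi> + real_of_int l * ?s) * h \<xi> \<partial>lborel)" for l
  proof -
    have "(\<integral>\<^sup>+\<xi>\<in>ess_support f. ennreal ((norm (f (\<xi> + real_of_int l * ?s) * ?g \<xi>))\<^sup>2) \<partial>lebesgue)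
        \<le> (\<integral>\<^sup>+\<xi>. ennreal (B\<^sup>2 * a m) * (indicator ?J (\<xi> + real_of_int l * ?s) * h \<xi>) \<partial>lborel)"
      \<comment> \<open>The integral is the same over \<open>lborel\<close>, also for integrands
        that are not Borel, so an almost everywhere comparison with the Borel function
        \<open>h\<close> suffices.\<close>
      unfolding nn_integral_completion
    proof (rule nn_integral_mono_AE)
      show "AE \<xi> in lborel. ennreal ((norm (f (\<xi> + real_of_int l * ?s) * ?g \<xi>))\<^sup>2) * indicator (ess_support f) \<xi>
          \<le> ennreal (B\<^sup>2 * a m) * (indicator ?J (\<xi> + real_of_int l * ?s) * h \<xi>)"
        using g AE_lborel_shift[OF f_bound, of "real_of_int l * ?s"]
      proof eventually_elim
        case (elim \<xi>)
        show ?case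
        proof (cases "\<xi> \<in> ess_support f")
          case True
          then have "ennreal ((norm (f (\<xi> + real_of_int l * ?s) * ?g \<xi>))\<^sup>2)
              = ennreal ((norm (f (\<xi> + real_of_int l * ?s)))\<^sup>2) * (ennreal (a m) * h \<xi>)"
            using elim(1) supp by (auto simp: norm_mult power_mult_distrib ennreal_mult)
          also have "\<dots> \<le> ennreal (B\<^sup>2 * indicator ?J (\<xi> + real_of_int l * ?s)) * (ennreal (a m) * h \<xi>)"
            using elim(2) by (intro mult_right_mono ennreal_leI) (auto simp: add.commute)
          also have "\<dots> = ennreal (B\<^sup>2 * a m) * (indicator ?J (\<xi> + real_of_int l * ?s) * h \<xi>)"
            using a by (auto simp: indicator_def ennreal_mult mult_ac)
          finally show ?thesis
            using True by simp
        qed auto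
      qed
    qed
    also have "\<dots> = ennreal (B\<^sup>2 * a m) * (\<integral>\<^sup>+\<xi>. indicator ?J (\<xi> + real_of_int l * ?s) * h \<xi> \<partial>lborel)"
      by (rule nn_integral_cmult) measurable
    finally have "ennreal ?s * (\<integral>\<^sup>+\<xi>\<in>ess_support f. ennreal ((norm (f (\<xi> + real_of_int l * ?s) * ?g \<xi>))\<^sup>2) \<partial>lebesgue)
        \<le> ennreal ?s * (ennreal (B\<^sup>2 * a m) * (\<integral>\<^sup>+\<xi>. indicator ?J (\<xi> + real_of_int l * ?s) * h \<xi> \<partial>lborel))"
      by (rule mult_left_mono) simp
    also have "\<dots> = ennreal (?s * (B\<^sup>2 * a m)) * (\<integral>\<^sup>+\<xi>. indicator ?J (\<xi> + real_of_int l * ?s) * h \<xi> \<partial>lborel)"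
      using a by (simp add: ennreal_mult mult.assoc)
    \<comment> \<open>The prefactor of the LIC cancels the normalization of the response.\<close>
    also have "?s * (B\<^sup>2 * a m) = B\<^sup>2"
      using a by simp
    finally show ?thesis .
  qed
  then have "(\<Sum>l\<in>F. ennreal ?s * (\<integral>\<^sup>+\<xi>\<in>ess_support f. ennreal ((norm (f (\<xi> + real_of_int l * ?s) * ?g \<xi>))\<^sup>2) \<partial>lebesgue))
      \<le> ennreal (B\<^sup>2) * (\<Sum>l\<in>F. \<integral>\<^sup>+\<xi>. indicator ?J (\<xi> + real_of_int l * ?s) * h \<xi> \<partial>lborel)"
    unfolding sum_distrib_left by (intro sum_mono)
  also have "(\<Sum>l\<in>F. \<integral>\<^sup>+\<xi>. indicator ?J (\<xi> + real_of_int l * ?s) * h \<xi> \<partial>lborel)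
      = (\<integral>\<^sup>+\<xi>. (\<Sum>l\<in>F. indicator ?J (\<xi> + real_of_int l * ?s)) * h \<xi> \<partial>lborel)"
    unfolding sum_distrib_right by (rule nn_integral_sum[symmetric]) measurable
  also have "\<dots> \<le> (\<integral>\<^sup>+\<xi>. ennreal (1 + (inv_into D \<Phi> \<beta> - inv_into D \<Phi> \<alpha>) / ?s) * h \<xi> \<partial>lborel)"
    using \<open>finite F\<close> s warping_function_inverse_less[OF assms(1,2)]
    by (intro nn_integral_mono mult_right_mono sum_indicator_translates_le) auto
  also have "\<dots> = ennreal (1 + (inv_into D \<Phi> \<beta> - inv_into D \<Phi> \<alpha>) * a m) * (\<integral>\<^sup>+\<xi>. h \<xi> \<partial>lborel)"
    by (simp add: nn_integral_cmult divide_inverse)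
  finally show "(\<Sum>l\<in>F. ennreal ?s * (\<integral>\<^sup>+\<xi>\<in>ess_support f. ennreal ((norm (f (\<xi> + real_of_int l * ?s) * ?g \<xi>))\<^sup>2) \<partial>lebesgue))
      \<le> ennreal (B\<^sup>2) * (ennreal (1 + (inv_into D \<Phi> \<beta> - inv_into D \<Phi> \<alpha>) * a m)
        * (\<integral>\<^sup>+\<xi>. H (\<Phi> \<xi> - real_of_int m) * indicator ?J \<xi> \<partial>lborel))"
    unfolding h_def by (simp add: mult_left_mono)
qed

section \<open>Assembling the estimates\<close>

lemma satisfies_LIC_warped_filter_bank:
  fixes a :: "int \<Rightarrow> real"
  assumes "warping_function D \<Phi>"
    and v: "weight v" "moderate v (warping_weight D \<Phi>)"
    and \<theta>: "\<theta> \<in> L2_weighted (\<lambda>x. sqrt (v x))"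
    and a: "\<And>m. 0 < a m" "bdd_above (range (\<lambda>m::int. a m * warping_weight D \<Phi> (real_of_int m)))"
    and ess: "esssup lebesgue (\<lambda>\<tau>::real. \<Sum>\<^sub>\<infinity>m::int. ennreal ((norm (\<theta> (\<tau> - real_of_int m)))\<^sup>2)) < \<infinity>"
      (is "?M < \<infinity>")
  shows "satisfies_LIC D (warped_filter_bank D \<Phi> \<theta> a)"
  unfolding satisfies_LIC_def
proof
  fix f
  assume "f \<in> LIC_test_functions D"
  then obtain B where B: "AE x in lebesgue. norm (f x) \<le> B"
    and supp: "compact (ess_support f)" "ess_support f \<subseteq> D"
    unfolding LIC_test_functions_def Linf_on_def by blast
  obtain \<alpha> \<beta> where ab: "\<alpha> < \<beta>" and J: "ess_support f \<subseteq> {inv_into D \<Phi> \<alpha>..inv_into D \<Phi> \<beta>}"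
    using compact_in_warped_interval[OF assms(1) supp] .
  let ?J = "{inv_into D \<Phi> \<alpha>..inv_into D \<Phi> \<beta>}"
  obtain C where C: "\<And>m::int. a m * warping_weight D \<Phi> (real_of_int m) \<le> C"
    using a(2) unfolding bdd_above_def by blast
  have [measurable]: "\<theta> \<in> borel_measurable lebesgue"
    using \<theta> unfolding L2_weighted_def by blast
  have "(\<lambda>t. ennreal ((norm (\<theta> t))\<^sup>2)) \<in> borel_measurable lebesgue"
    by measurable
  \<comment> \<open>Composing a merely Lebesgue measurable function with \<open>\<Phi>\<close> could
    destroy measurability, so a Borel version is chosen.\<close>
  from completion_ex_borel_measurable[OF this]
  obtain H where H[measurable]: "H \<in> borel_measurable borel"
    and \<theta>H: "AE t in lborel. ennreal ((norm (\<theta> t))\<^sup>2) = H t"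
    by auto
  \<comment> \<open>One null set serves all integer shifts, as there are countably many.\<close>
  have shifted: "AE \<tau> in lborel. \<forall>m\<in>UNIV. ennreal ((norm (\<theta> (- real_of_int m + \<tau>)))\<^sup>2) = H (- real_of_int m + \<tau>)"
    by (intro AE_ball_countable' AE_lborel_shift[OF \<theta>H]) auto
  have H_le: "AE \<tau> in lborel. (\<Sum>m\<in>F. H (\<tau> - real_of_int m)) \<le> ?M" if "finite F" for F
  proof -
    have "AE \<tau> in lborel. (\<Sum>\<^sub>\<infinity>m::int. ennreal ((norm (\<theta> (\<tau> - real_of_int m)))\<^sup>2)) \<le> ?M"
      by (subst AE_completion_iff[symmetric]) (rule esssup_AE)
    with shifted show ?thesis
    proof eventually_elim
      case (elim \<tau>)
      then have "(\<Sum>m\<in>F. H (\<tau> - real_of_int m)) = (\<Sum>m\<in>F. ennreal ((norm (\<theta> (\<tau> - real_of_int m)))\<^sup>2))"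
        by simp
      also have "\<dots> \<le> (\<Sum>\<^sub>\<infinity>m::int. ennreal ((norm (\<theta> (\<tau> - real_of_int m)))\<^sup>2))"
        using that by (intro sum_le_infsum_ennreal) auto
      finally show ?case
        using elim(2) by simp
    qed
  qed
  \<comment> \<open>Squaring \<open>sqrt (v t)\<close> gives \<open>v t\<close>, so this integral is
    the squared weighted norm of \<open>\<theta>\<close>, finite by assumption.\<close>
  have "(\<integral>\<^sup>+t. ennreal (v t) * H t \<partial>lborel) = (\<integral>\<^sup>+t. ennreal ((norm (complex_of_real (sqrt (v t)) * \<theta> t))\<^sup>2) \<partial>lebesgue)"
    unfolding nn_integral_completion
  proof (rule nn_integral_cong_AE)
    show "AE t in lborel. ennreal (v t) * H t = ennreal ((norm (complex_of_real (sqrt (v t)) * \<theta> t))\<^sup>2)"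
      using \<theta>H
    proof eventually_elim
      case (elim t)
      moreover have "0 < v t"
        using v(1) unfolding weight_def by blast
      ultimately show ?case
        by (simp add: norm_mult power_mult_distrib ennreal_mult)
    qed
  qed
  then have vH: "(\<integral>\<^sup>+t. ennreal (v t) * H t \<partial>lborel) < \<infinity>"
    using \<theta> unfolding L2_weighted_def by simp
  define I where "I m = (\<integral>\<^sup>+\<xi>. H (\<Phi> \<xi> - real_of_int m) * indicator ?J \<xi> \<partial>lborel)" for m :: int
  define L where "L = inv_into D \<Phi> \<beta> - inv_into D \<Phi> \<alpha>"
  have "0 < L"
    using warping_function_inverse_less[OF assms(1) ab] unfolding L_def by simp
  \<comment> \<open>The two summands come from splitting \<open>1 + L * a m\<close>.
    \<open>T\<close> is independent of the finite index set \<open>F\<close> below, so it bounds the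
    full sum.\<close>
  define T where "T = ennreal (B\<^sup>2) * (?M * ennreal L
    + ennreal L * (ennreal C * (ennreal (1 + (\<beta> - \<alpha>)) * (\<integral>\<^sup>+t. ennreal (v t) * H t \<partial>lborel))))"
  have "LIC_sum (warped_filter_bank D \<Phi> \<theta> a) f \<le> T"
    unfolding LIC_sum_def
  proof (rule infsum_ennreal_leI)
    fix F :: "int set"
    assume F: "finite F"
    have dec: "decimation (warped_filter_bank D \<Phi> \<theta> a) = a"
      by (simp add: warped_filter_bank_def)
    have "(\<Sum>m\<in>F. \<Sum>\<^sub>\<infinity>l::int. ennreal (inverse (a m)) * (\<integral>\<^sup>+\<xi>\<in>ess_support f. ennreal ((norm
          (f (\<xi> + real_of_int l * inverse (a m)) * response (warped_filter_bank D \<Phi> \<theta> a) m \<xi>))\<^sup>2) \<partial>lebesgue))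
        \<le> (\<Sum>m\<in>F. ennreal (B\<^sup>2) * (ennreal (1 + L * a m) * I m))"
      unfolding I_def L_def by (intro sum_mono LIC_inner_sum_le assms(1) ab a B J H \<theta>H)
    also have "\<dots> = ennreal (B\<^sup>2) * ((\<Sum>m\<in>F. I m) + ennreal L * (\<Sum>m\<in>F. ennreal (a m) * I m))"
    proof -
      have "ennreal (1 + L * a m) * I m = I m + ennreal L * (ennreal (a m) * I m)" for m
        using \<open>0 < L\<close> a(1)[of m] by (simp add: ennreal_plus ennreal_mult less_imp_le distrib_right mult.assoc)
      then show ?thesis
        by (simp only: sum.distrib sum_distrib_left[symmetric])
    qed
    also have "\<dots> \<le> T"
      unfolding T_def I_def L_def
      by (intro mult_left_mono add_mono sum_warped_translates_le sum_weighted_warped_translates_le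
          assms(1) H ab F H_le v a(1) C) auto
    finally show "(\<Sum>m\<in>F. \<Sum>\<^sub>\<infinity>l::int. ennreal (inverse (decimation (warped_filter_bank D \<Phi> \<theta> a) m)) *
        (\<integral>\<^sup>+\<xi>\<in>ess_support f. ennreal ((norm (f (\<xi> + real_of_int l * inverse (decimation (warped_filter_bank D \<Phi> \<theta> a) m))
          * response (warped_filter_bank D \<Phi> \<theta> a) m \<xi>))\<^sup>2) \<partial>lebesgue)) \<le> T"
      unfolding dec .
  qed
  also have "T < \<infinity>"
    using ess vH unfolding T_def by (simp add: ennreal_mult_less_top)
  finally show "LIC_sum (warped_filter_bank D \<Phi> \<theta> a) f < \<infinity>" .
qed

text \<open>Positivity of the weight lets it cancel, leaving the constant \<open>c\<close> for every
  \<open>m\<close>; this reduces natural decimation to the general case.\<close>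

lemma natural_decimation_bdd_above:
  assumes "warping_function D \<Phi>" "natural_decimation D \<Phi> a"
  shows "bdd_above (range (\<lambda>m::int. a m * warping_weight D \<Phi> (real_of_int m)))"
proof -
  obtain c where "\<And>m. a m = c / warping_weight D \<Phi> (real_of_int m)"
    using assms(2) unfolding natural_decimation_def by blast
  moreover have "warping_weight D \<Phi> y \<noteq> 0" for y
    using warping_function_inverse_deriv(2)[OF assms(1)] by (metis less_irrefl)
  ultimately show ?thesis
    by simp
qed

theorem theorem4p2:
  fixes D :: "real set" and \<Phi> v :: "real \<Rightarrow> real" and \<theta> :: "real \<Rightarrow> complex"
    and a :: "int \<Rightarrow> real"
  assumes "warping_function D \<Phi>"
    and "weight v" and "submultiplicative v" and "moderate v (warping_weight D \<Phi>)"
    and "\<theta> \<in> L2_weighted (\<lambda>x. sqrt (v x))"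
    and "\<forall>m. 0 < a m"
  shows "(bdd_above (range (\<lambda>m::int. a m * warping_weight D \<Phi> (real_of_int m))) \<and>
          esssup lebesgue (\<lambda>\<tau>::real. \<Sum>\<^sub>\<infinity>m::int. ennreal ((norm (\<theta> (\<tau> - real_of_int m)))\<^sup>2)) < \<infinity>
            \<longrightarrow> satisfies_LIC D (warped_filter_bank D \<Phi> \<theta> a)) \<and>
         (natural_decimation D \<Phi> a \<and>
          esssup lebesgue (\<lambda>\<tau>::real. \<Sum>\<^sub>\<infinity>m::int. ennreal ((norm (\<theta> (\<tau> - real_of_int m)))\<^sup>2)) < \<infinity>
            \<longrightarrow> satisfies_LIC D (warped_filter_bank D \<Phi> \<theta> a))"
proof (intro conjI impI; elim conjE)
  note LIC = satisfies_LIC_warped_filter_bank[OF assms(1,2,4,5) assms(6)[THEN spec]]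
  let ?bdd = "bdd_above (range (\<lambda>m::int. a m * warping_weight D \<Phi> (real_of_int m)))"
  let ?ess = "esssup lebesgue (\<lambda>\<tau>::real. \<Sum>\<^sub>\<infinity>m::int. ennreal ((norm (\<theta> (\<tau> - real_of_int m)))\<^sup>2)) < \<infinity>"
  show "satisfies_LIC D (warped_filter_bank D \<Phi> \<theta> a)" if ?bdd ?ess
    using that by (rule LIC)
  show "satisfies_LIC D (warped_filter_bank D \<Phi> \<theta> a)" if "natural_decimation D \<Phi> a" ?ess
    using natural_decimation_bdd_above[OF assms(1) that(1)] that(2) by (rule LIC)
qed

end
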